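(* Let $(\mathbb{U},\|\cdot\|_{\mathbb{U}})$ and $(\mathbb{V},\|\cdot\|_{\mathbb{V}})$ be Hilbert spaces, and let $\|\cdot\|_{\mathbb{V},\omega}$ be the norm inherited from a weighted inner product $(\cdot,\cdot)_{\mathbb{V},\omega}$ on $\mathbb{V}$, equivalent to $\|\cdot\|_{\mathbb{V}}$ in the sense that there exist constants $C_{1,\omega}>0$ and $C_{2,\omega}>0$ such that $$C_{1,\omega}\|v\|_{\mathbb{V},\omega}\leq \|v\|_{\mathbb{V}}\leq C_{2,\omega}\|v\|_{\mathbb{V},\omega}\qquad\forall v\in\mathbb{V}.$$ Let $b:\mathbb{U}\times\mathbb{V}\to\mathbb{R}$ be a bilinear form for which there exist constants $M_\omega>0$ and $\gamma_\omega>0$ such that $$\gamma_\omega\|u\|_{\mathbb{U}}\leq \sup_{v\in\mathbb{V}}\frac{|b(u,v)|}{\|v\|_{\mathbb{V},\omega}}\leq M_\omega\|u\|_{\mathbb{U}}\qquad\forall u\in\mathbb{U}.$$ Let $\{\ell_\lambda\}_{\lambda\in\Lambda}\subset\mathbb{V}^*$ be a family of functionals such that, for any $\lambda\in\Lambda$, $\ell_\lambda(v)=0$ for all $v\in\mathbb{V}$ such that $b(\cdot,v)=0\in\mathbb{U}^*$. For each $\lambda\in\Lambda$, let $u_\lambda\in\mathbb{U}$ be the solution (which exists and is unique under these hypotheses) of $$b(u_\lambda,v)=\ell_\lambda(v)\qquad\forall v\in\mathbb{V}.$$ Let $\mathbb{U}_h\subset\mathbb{U}$ and $\mathbb{V}_h\subset\mathbb{V}$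 be finite-dimensional subspaces such that $\dim\mathbb{V}_h\geq\dim\mathbb{U}_h$, and such that the following discrete inf-sup condition is satisfied: $$\sup_{v_h\in\mathbb{V}_h}\frac{|b(u_h,v_h)|}{\|v_h\|_{\mathbb{V},\omega}}\geq\gamma_{h,\omega}\|u_h\|_{\mathbb{U}}\qquad\forall u_h\in\mathbb{U}_h,$$ where $\gamma_{h,\omega}>0$ is the associated discrete inf-sup constant. Then, for each $\lambda\in\Lambda$, the mixed system $$\begin{cases}(r_{h,\lambda,\omega},v_h)_{\mathbb{V},\omega}+b(u_{h,\lambda,\omega},v_h)=\ell_\lambda(v_h) & \forall v_h\in\mathbb{V}_h,\\ b(w_h,r_{h,\lambda,\omega})=0 & \forall w_h\in\mathbb{U}_h,\end{cases}$$ has a unique solution $(r_{h,\lambda,\omega},u_{h,\lambda,\omega})\in\mathbb{V}_h\times\mathbb{U}_h$. Moreover, $u_{h,\lambda,\omega}$ satisfies the a priori estimates $$\|u_{h,\lambda,\omega}\|_{\mathbb{U}}\leq\frac{M_\omega}{\gamma_{h,\omega}}\|u_\lambda\|_{\mathbb{U}}\qquad\text{and}\qquad \|u_\lambda-u_{h,\lambda,\omega}\|_{\mathbb{U}}\leq\frac{M_\omega}{\gamma_{h,\omega}}\inf_{u_h\in\mathbb{U}_h}\|u_\lambda-u_h\|_{\mathbb{U}}.$$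
   Context: $\mathbb{U}^*$ and $\mathbb{V}^*$ denote the dual spaces of $\mathbb{U}$ and $\mathbb{V}$ (continuous linear functionals). Suprema of quotients with $\|v\|_{\mathbb{V},\omega}$ or $\|v_h\|_{\mathbb{V},\omega}$ in the denominator are taken over nonzero vectors. $\Lambda$ is a set of parameters, and $\ell_\lambda$ may depend non-affinely on $\lambda$. The subscript $\omega$ is a label for a fixed weight, which enters only through the inner product $(\cdot,\cdot)_{\mathbb{V},\omega}$ and its induced norm.
   Formalization: The last (error) estimate is stated only for a nonzero trial space U_h: for U_h = {0} the discrete inf-sup condition is vacuous, γ_h may exceed M, and the estimate then fails for nonzero u_λ. *)

theory Defs
  imports "HOL-Analysis.Analysis"
begin

definition is_inner_product :: "('v::real_vector \<Rightarrow> 'v \<Rightarrow> real) \<Rightarrow> bool" where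
  "is_inner_product ip \<longleftrightarrow>
     bilinear ip \<and> (\<forall>x y. ip x y = ip y x) \<and> (\<forall>x. x \<noteq> 0 \<longrightarrow> ip x x > 0)"

definition ip_norm :: "('v \<Rightarrow> 'v \<Rightarrow> real) \<Rightarrow> 'v \<Rightarrow> real" where
  "ip_norm ip v = sqrt (ip v v)"

text \<open>The supremum lives in \<open>ennreal\<close>, so that it is \<open>\<infinity>\<close> for an unbounded quotient (whereas \<open>Sup\<close>
  on \<open>real\<close> would be unspecified) and \<open>0\<close> when \<open>S\<close> has no nonzero vector.\<close>

definition sup_quotient ::
    "('v::real_vector \<Rightarrow> 'v \<Rightarrow> real) \<Rightarrow> 'v set \<Rightarrow> ('v \<Rightarrow> real) \<Rightarrow> ennreal" where
  "sup_quotient ip S f = (SUP v\<in>S - {0}. ennreal (\<bar>f v\<bar> / ip_norm ip v))"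

definition finite_dim_subspace :: "'a::real_vector set \<Rightarrow> bool" where
  "finite_dim_subspace S \<longleftrightarrow> subspace S \<and> (\<exists>B. finite B \<and> span B = S)"

definition variational_solution ::
    "('u \<Rightarrow> 'v::real_normed_vector \<Rightarrow> real) \<Rightarrow> ('v \<Rightarrow>\<^sub>L real) \<Rightarrow> 'u \<Rightarrow> bool" where
  "variational_solution b f u \<longleftrightarrow> (\<forall>v. b u v = blinfun_apply f v)"

definition mixed_solution ::
    "('v::real_normed_vector \<Rightarrow> 'v \<Rightarrow> real) \<Rightarrow> ('u \<Rightarrow> 'v \<Rightarrow> real) \<Rightarrow> ('v \<Rightarrow>\<^sub>L real)
      \<Rightarrow> 'v set \<Rightarrow> 'u set \<Rightarrow> 'v \<times> 'u \<Rightarrow> bool" where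
  "mixed_solution ip b f Vh Uh p \<longleftrightarrow> (case p of (r, u) \<Rightarrow>
     r \<in> Vh \<and> u \<in> Uh \<and>
     (\<forall>v\<in>Vh. ip r v + b u v = blinfun_apply f v) \<and>
     (\<forall>w\<in>Uh. b w r = 0))"

end

theory Submission imports Defs begin

text \<open>The weak problem and its discretisation are two instances of one saddle point problem, posed on a
  complete test space \<open>H\<close> and a complete trial space \<open>K\<close>: find \<open>r \<in> H\<close> and \<open>u \<in> K\<close> with
  \<open>ip r v + b u v = f v\<close> on \<open>H\<close> and \<open>b w r = 0\<close> on \<open>K\<close>. Such a pair describes a least squares
  problem. By the Riesz theorem, \<open>b u\<close> and \<open>f\<close> are represented on \<open>H\<close> by vectors \<open>T u\<close> and \<open>g\<close>;
  then \<open>T u\<close> is the \<open>ip\<close>-orthogonal projection of \<open>g\<close> onto \<open>T ` K\<close>, and \<open>r = g - T u\<close> is its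
  residual. The inf-sup condition says that \<open>T\<close> is bounded below on \<open>K\<close>, so that
  \<open>ip (T u) (T w)\<close> is coercive on \<open>K\<close> and minimisation of a quadratic functional yields the unique
  solution (\<open>mixed_solution_ex1\<close>). On the full spaces every \<open>b w\<close> vanishes at the residual,
  and so does \<open>f\<close> by the compatibility condition. The first equation, tested with \<open>r\<close> itself, then forces
  \<open>r = 0\<close>, and the saddle point problem becomes the weak problem
  (\<open>mixed_solution_full_space\<close>). On finite-dimensional subspaces it is the discrete mixed system.

  For the estimates, let \<open>u\<close> satisfy \<open>f = b u\<close> and let \<open>uh\<close> be the discrete solution. Testing with
  \<open>T uh\<close>, which is orthogonal to the residual, gives
  \<open>ip (T uh) (T uh) = b u (T uh)\<close>, and the discrete inf-sup condition turns this into the bound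
  \<open>M / \<gamma>h\<close> for the map \<open>u \<mapsto> uh\<close> (\<open>mixed_solution_stable\<close>). This map is a linear projection onto the
  trial space. In an inner product space the complement \<open>x \<mapsto> x - P x\<close> of a nonzero projection \<open>P\<close>
  satisfies every norm bound of \<open>P\<close> (\<open>norm_complement_projection_le\<close>), which is why the constant of
  quasi-optimality is \<open>M / \<gamma>h\<close> and not \<open>1 + M / \<gamma>h\<close>: the error does not change when an element \<open>w\<close>
  of the trial space is subtracted from both \<open>u\<close> and \<open>uh\<close>, so it is at most
  \<open>M / \<gamma>h * norm (u - w)\<close>.\<close>

section \<open>Facts about Hilbert spaces\<close>

text \<open>The representing vector minimises the energy \<open>J x = a x x - 2 * f x\<close> over \<open>S\<close>: coercivity
  bounds \<open>J\<close> below, the parallelogram law for \<open>a\<close> makes minimising sequences Cauchy, and the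
  variation of \<open>J\<close> in direction \<open>v\<close> vanishes at the minimiser. Coercivity
  is asked for on \<open>S\<close> alone to cover forms \<open>ip (T u) (T w)\<close> with \<open>T\<close> bounded below on a subspace.\<close>

lemma coercive_form_represents_functional:
  fixes a :: "'a::real_normed_vector \<Rightarrow> 'a \<Rightarrow> real"
  assumes a: "bounded_bilinear a" and sym: "\<And>x y. a x y = a y x"
    and c: "c > 0" and coercive: "\<And>x. x \<in> S \<Longrightarrow> c * (norm x)\<^sup>2 \<le> a x x"
    and f: "bounded_linear f"
    and S: "subspace S" "complete S"
  shows "\<exists>x\<in>S. \<forall>v\<in>S. a x v = f v"
proof -
  interpret a: bounded_bilinear a by (rule a)
  interpret f: bounded_linear f by (rule f)
  define J where "J = (\<lambda>x. a x x - 2 * f x)"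
  obtain K where K: "K > 0" "\<And>x. norm (f x) \<le> norm x * K"
    using f.pos_bounded by blast
  have J_lower: "- (K\<^sup>2 / c) \<le> J x" if "x \<in> S" for x
  proof -
    \<comment> \<open>Completing the square in \<open>c |x|^2 - 2 K |x|\<close>, a lower bound of \<open>J x\<close>.\<close>
    have "0 \<le> (c * norm x - K)\<^sup>2" by simp
    then have "- (K\<^sup>2) \<le> c * (c * (norm x)\<^sup>2 - 2 * (norm x * K))"
      by (simp add: power2_eq_square algebra_simps)
    also have "\<dots> \<le> c * J x"
      using coercive[OF that] K(2)[of x] c by (intro mult_left_mono) (auto simp: J_def)
    finally show ?thesis using c by (simp add: field_simps)
  qed
  define d where "d = (INF x\<in>S. J x)"
  have "0 \<in> S" using S(1) by (rule subspace_0)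
  have bdd: "bdd_below (J ` S)" using J_lower by (auto intro!: bdd_belowI)
  have d_le: "d \<le> J x" if "x \<in> S" for x
    unfolding d_def using bdd that by (rule cINF_lower)
  have "\<exists>x\<in>S. J x < d + 1 / Suc n" for n
  proof (rule ccontr)
    assume "\<not> ?thesis"
    then have "d + 1 / Suc n \<le> d"
      unfolding d_def using \<open>0 \<in> S\<close> by (intro cINF_greatest) (auto simp: not_less)
    then show False by simp
  qed
  then obtain x where x: "\<And>n. x n \<in> S" "\<And>n. J (x n) < d + 1 / Suc n" by metis
  have parallelogram: "c / 2 * (norm (y - z))\<^sup>2 \<le> (J y - d) + (J z - d)"
    if "y \<in> S" "z \<in> S" for y z
  proof -
    have "(1/2) *\<^sub>R (y + z) \<in> S" "y - z \<in> S"
      using S(1) that by (auto intro: subspace_scale subspace_add subspace_diff)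
    moreover have "J y + J z - 2 * J ((1/2) *\<^sub>R (y + z)) = a (y - z) (y - z) / 2"
      by (simp add: J_def a.add_left a.add_right a.diff_left a.diff_right a.scaleR_left
          a.scaleR_right f.add f.scaleR sym[of z y] field_simps)
    ultimately show ?thesis
      using d_le[of "(1/2) *\<^sub>R (y + z)"] coercive[of "y - z"] by simp
  qed
  have "Cauchy x"
  proof (rule metric_CauchyI)
    fix e :: real assume "e > 0"
    obtain N where N: "4 / (c * e\<^sup>2) < real N" using reals_Archimedean2 by blast
    have "0 < real N" using N c \<open>e > 0\<close> by (smt (verit) divide_pos_pos mult_pos_pos zero_less_power)
    have small: "J (x n) - d < c / 4 * e\<^sup>2" if "n \<ge> N" for n
    proof -
      have "J (x n) - d < 1 / Suc n" using x(2)[of n] by simp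
      also have "\<dots> \<le> 1 / real N" using that \<open>0 < real N\<close> by (intro divide_left_mono) auto
      also have "\<dots> \<le> c / 4 * e\<^sup>2" using N c \<open>e > 0\<close> \<open>0 < real N\<close> by (simp add: field_simps)
      finally show ?thesis .
    qed
    show "\<exists>N. \<forall>m\<ge>N. \<forall>n\<ge>N. dist (x m) (x n) < e"
    proof (intro exI allI impI)
      fix m n assume "m \<ge> N" "n \<ge> N"
      then have "c / 2 * (norm (x m - x n))\<^sup>2 < c / 2 * e\<^sup>2"
        using parallelogram[OF x(1) x(1), of m n] small[of m] small[of n] by simp
      then have "(norm (x m - x n))\<^sup>2 < e\<^sup>2" using c by simp
      then show "dist (x m) (x n) < e"
        using \<open>e > 0\<close> by (simp add: dist_norm power_less_imp_less_base)
    qed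
  qed
  then obtain l where l: "l \<in> S" "x \<longlonglongrightarrow> l"
    using S(2) x(1) unfolding complete_def by blast
  have "(\<lambda>n. J (x n)) \<longlonglongrightarrow> J l"
    unfolding J_def by (intro tendsto_intros a.tendsto f.tendsto l(2))
  moreover have "(\<lambda>n. d + 1 / Suc n) \<longlonglongrightarrow> d + 0"
    by (intro tendsto_intros LIMSEQ_Suc[OF lim_1_over_n])
  ultimately have "J l \<le> d"
    using x(2) by (intro LIMSEQ_le[of "\<lambda>n. J (x n)" _ "\<lambda>n. d + 1 / Suc n"])
      (auto intro: less_imp_le)
  have "a l v = f v" if "v \<in> S" for v
  proof -
    define e q where "e = a l v - f v" and "q = a v v"
    have "0 \<le> c * (norm v)\<^sup>2" using c by simp
    then have q: "q \<ge> 0" using coercive[OF that] by (simp add: q_def)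
    \<comment> \<open>This step length makes \<open>J (l + t v) - J l\<close> negative unless \<open>e = 0\<close>; the minimiser of the
      quadratic would be \<open>- e / q\<close>, but \<open>q\<close> may vanish.\<close>
    define t where "t = - e / (q + 1)"
    have "J l \<le> J (l + t *\<^sub>R v)"
      using \<open>J l \<le> d\<close> d_le S(1) l(1) that
      by (meson order_trans subspace_add subspace_scale)
    also have "\<dots> = J l + (2 * t * e + t\<^sup>2 * q)"
      by (simp add: J_def e_def q_def a.add_left a.add_right a.scaleR_left a.scaleR_right
          f.add f.scaleR sym[of v l] power2_eq_square algebra_simps)
    finally have "0 \<le> (2 * t * e + t\<^sup>2 * q) * (q + 1)\<^sup>2" by simp
    also have "\<dots> = 2 * (t * (q + 1)) * e * (q + 1) + (t * (q + 1))\<^sup>2 * q"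
      by (simp add: power2_eq_square algebra_simps)
    also have "t * (q + 1) = - e" using q by (simp add: t_def)
    finally have "e\<^sup>2 * (q + 2) \<le> 0" by (simp add: power2_eq_square algebra_simps)
    then have "e = 0" using q by (simp add: mult_le_0_iff)
    then show ?thesis by (simp add: e_def)
  qed
  then show ?thesis using l(1) by blast
qed

text \<open>Split \<open>x\<close> as \<open>p + q\<close> with \<open>p = P x\<close>. Rescaling \<open>p\<close> to the length of \<open>q\<close> and \<open>q\<close> to the
  length of \<open>p\<close> gives a vector \<open>y\<close> with the same norm as \<open>x\<close>, because the inner product of the two
  parts is unchanged; and \<open>P y\<close> has the norm of \<open>q\<close>. So the bound of \<open>P\<close> at \<open>y\<close> is the bound of the
  complement at \<open>x\<close>. For \<open>p = 0\<close> the claim says \<open>1 \<le> C\<close>, which fails for \<open>C < 1\<close> and \<open>P = 0\<close>; a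
  vector with \<open>P z \<noteq> 0\<close> excludes this.\<close>

lemma norm_complement_projection_le:
  fixes P :: "'a::real_inner \<Rightarrow> 'a"
  assumes P: "linear P" and idem: "\<And>x. P (P x) = P x"
    and bound: "\<And>x. norm (P x) \<le> C * norm x" and nonzero: "P z \<noteq> 0"
  shows "norm (x - P x) \<le> C * norm x"
proof -
  interpret P: linear P by (rule P)
  have "1 * norm (P z) \<le> C * norm (P z)" using bound[of "P z"] by (simp add: idem)
  then have "1 \<le> C" using nonzero by (metis mult_right_le_imp_le zero_less_norm_iff)
  define p q where "p = P x" and "q = x - P x"
  have Pp: "P p = p" and Pq: "P q = 0" and x: "x = p + q"
    by (simp_all add: p_def q_def idem P.diff)
  have "norm q \<le> C * norm x"
  proof (cases "p = 0 \<or> q = 0")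
    case True
    with \<open>1 \<le> C\<close> show ?thesis
      using mult_right_mono[of 1 C "norm q"] by (auto simp: x)
  next
    case False
    define y where "y = (norm q / norm p) *\<^sub>R p + (norm p / norm q) *\<^sub>R q"
    have "inner y y =
        (norm q / norm p)\<^sup>2 * (norm p)\<^sup>2 + 2 * inner p q + (norm p / norm q)\<^sup>2 * (norm q)\<^sup>2"
      using False
      by (simp add: y_def inner_add_left inner_add_right inner_commute[of q p]
          power2_norm_eq_inner) (simp add: power2_eq_square add_divide_distrib distrib_left distrib_right)
    also have "\<dots> = (norm q)\<^sup>2 + 2 * inner p q + (norm p)\<^sup>2"
      using False by (simp add: power_divide)
    also have "\<dots> = inner x x"
      by (simp add: x inner_add_left inner_add_right inner_commute[of q p] power2_norm_eq_inner)
    finally have "norm y = norm x" by (simp add: norm_eq_sqrt_inner)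
    moreover have "norm (P y) = norm q"
      using False by (simp add: y_def P.add P.scale Pp Pq)
    ultimately show ?thesis using bound[of y] by simp
  qed
  then show ?thesis by (simp add: q_def)
qed

text \<open>For an orthogonal spanning set the Fourier sum \<open>P\<close> is continuous and the subspace is its set of
  fixed points.\<close>

lemma closed_finite_dim_subspace:
  fixes S :: "'a::real_inner set"
  assumes "finite_dim_subspace S"
  shows "closed S"
proof -
  from assms obtain B where "finite B" "span B = S" by (auto simp: finite_dim_subspace_def)
  with basis_orthogonal[of B] obtain C
    where C: "finite C" "span C = S" "pairwise orthogonal C" by auto
  \<comment> \<open>\<open>C\<close> may contain \<open>0\<close>; its summand vanishes since division by zero yields zero.\<close>
  define P where "P = (\<lambda>x. \<Sum>c\<in>C. (inner x c / inner c c) *\<^sub>R c)"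
  have P_in: "P x \<in> S" for x
    unfolding P_def C(2)[symmetric] by (intro span_sum span_scale span_base)
  have "linear P"
    by (rule linearI) (simp_all add: P_def inner_add_left add_divide_distrib scaleR_left_distrib
        sum.distrib scaleR_sum_right)
  have P_basis: "P c = c" if "c \<in> C" for c
  proof -
    have "P c = (\<Sum>c'\<in>C. if c' = c then c else 0)"
      unfolding P_def using that C(3)
      by (intro sum.cong refl) (auto simp: pairwise_def orthogonal_def)
    then show ?thesis using that C(1) by simp
  qed
  have P_fix: "P x = x" if "x \<in> S" for x
  proof -
    have "x \<in> span C" using that C(2) by simp
    then show ?thesis
      using linear_eq_on_span[OF \<open>linear P\<close> linear_id, of C] P_basis by auto
  qed
  have "S = {x. P x = x}" using P_in P_fix by (metis (mono_tags) Collect_cong Collect_mem_eq)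
  moreover have "closed {x. P x = x}"
    unfolding P_def divide_inverse
    by (intro closed_Collect_eq continuous_on_sum continuous_on_scaleR continuous_on_mult_right
        continuous_on_inner continuous_on_const continuous_on_id)
  ultimately show ?thesis by simp
qed

section \<open>Equivalent inner products\<close>

locale weighted_inner_product =
  fixes ip :: "'v::real_normed_vector \<Rightarrow> 'v \<Rightarrow> real" and C1 C2 :: real
  assumes ip: "is_inner_product ip"
    and C_pos: "C1 > 0" "C2 > 0"
    and norm_equiv: "\<And>v. C1 * ip_norm ip v \<le> norm v" "\<And>v. norm v \<le> C2 * ip_norm ip v"
begin

lemma ip_bilinear: "bilinear ip" and ip_commute: "ip x y = ip y x"
  and ip_pos: "x \<noteq> 0 \<Longrightarrow> 0 < ip x x"
  using ip by (auto simp: is_inner_product_def)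

lemma ip_nonneg: "0 \<le> ip x x"
  by (metis bilinear_rzero[OF ip_bilinear] ip_pos less_eq_real_def)

lemma ip_norm_power2: "(ip_norm ip x)\<^sup>2 = ip x x"
  by (simp add: ip_norm_def ip_nonneg)

lemma ip_norm_nonneg: "0 \<le> ip_norm ip x"
  by (simp add: ip_norm_def ip_nonneg)

lemma ip_norm_pos: "x \<noteq> 0 \<Longrightarrow> 0 < ip_norm ip x"
  by (simp add: ip_norm_def ip_pos)

lemma ip_norm_le: "ip_norm ip x \<le> norm x / C1"
  using norm_equiv(1)[of x] C_pos by (simp add: field_simps)

lemma ip_coercive: "1 / C2\<^sup>2 * (norm x)\<^sup>2 \<le> ip x x"
proof -
  have "(norm x)\<^sup>2 \<le> (C2 * ip_norm ip x)\<^sup>2"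
    using norm_equiv(2) by (intro power_mono) auto
  then show ?thesis using C_pos by (simp add: power_mult_distrib ip_norm_power2 field_simps)
qed

text \<open>Positivity at \<open>ip y y * x - ip x y * y\<close>, a multiple of the component of \<open>x\<close> orthogonal to \<open>y\<close>.\<close>

lemma ip_Cauchy_Schwarz: "\<bar>ip x y\<bar> \<le> ip_norm ip x * ip_norm ip y"
proof (cases "y = 0")
  case True
  then show ?thesis by (simp add: bilinear_rzero[OF ip_bilinear] ip_norm_nonneg)
next
  case False
  define z where "z = ip y y *\<^sub>R x - ip x y *\<^sub>R y"
  have "ip z z = ip y y * (ip x x * ip y y - (ip x y)\<^sup>2)"
    by (simp add: z_def bilinear_lsub[OF ip_bilinear] bilinear_rsub[OF ip_bilinear]
        bilinear_lmul[OF ip_bilinear] bilinear_rmul[OF ip_bilinear] ip_commute[of y x]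
        power2_eq_square algebra_simps)
  then have "(ip x y)\<^sup>2 \<le> ip x x * ip y y"
    using ip_nonneg[of z] ip_pos[OF False] by (simp add: zero_le_mult_iff)
  also have "\<dots> = (ip_norm ip x * ip_norm ip y)\<^sup>2"
    by (simp add: power_mult_distrib ip_norm_power2)
  finally show ?thesis
    by (meson abs_le_square_iff ip_norm_nonneg mult_nonneg_nonneg abs_of_nonneg order_trans
        power2_le_iff_abs_le)
qed

lemma bounded_bilinear_if_ip_bounded:
  fixes b :: "'u::real_normed_vector \<Rightarrow> 'v \<Rightarrow> real"
  assumes b: "bilinear b" and "0 \<le> M" and bound: "\<And>u v. \<bar>b u v\<bar> \<le> M * norm u * ip_norm ip v"
  shows "bounded_bilinear b"
proof
  show "\<exists>K. \<forall>u v. norm (b u v) \<le> norm u * norm v * K"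
  proof (intro exI allI)
    fix u v
    have "\<bar>b u v\<bar> \<le> M * norm u * (norm v / C1)"
      using bound[of u v] ip_norm_le[of v] \<open>0 \<le> M\<close> 
      by (smt (verit) mult_left_mono mult_nonneg_nonneg norm_ge_zero)
    then show "norm (b u v) \<le> norm u * norm v * (M / C1)" by (simp add: ac_simps)
  qed
qed (simp_all add: bilinear_ladd[OF b] bilinear_radd[OF b] bilinear_lmul[OF b] bilinear_rmul[OF b])

lemma bounded_bilinear_ip: "bounded_bilinear ip"
proof (rule bounded_bilinear_if_ip_bounded[OF ip_bilinear])
  show "0 \<le> 1 / C1" using C_pos by simp
  fix u v
  show "\<bar>ip u v\<bar> \<le> 1 / C1 * norm u * ip_norm ip v"
    using ip_Cauchy_Schwarz[of u v] ip_norm_le[of u] ip_norm_nonneg[of v]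
    by (smt (verit) mult_right_mono mult_cancel_right1 times_divide_eq_left)
qed

lemma Riesz_representation:
  assumes "bounded_linear f" "subspace S" "complete S"
  shows "\<exists>z\<in>S. \<forall>v\<in>S. ip z v = f v"
  by (rule coercive_form_represents_functional[where c = "1 / C2\<^sup>2"])
    (use assms C_pos ip_coercive ip_commute bounded_bilinear_ip in auto)

text \<open>The passage from the extended nonnegative reals to real inequalities: at \<open>0\<close>, which the
  supremum leaves out, the inequality on the right holds because \<open>g\<close> vanishes there.\<close>

lemma sup_quotient_le_iff:
  assumes "0 \<le> C" "g 0 = 0"
  shows "sup_quotient ip S g \<le> ennreal C \<longleftrightarrow> (\<forall>v\<in>S. \<bar>g v\<bar> \<le> C * ip_norm ip v)"
proof -
  have "ennreal (\<bar>g v\<bar> / ip_norm ip v) \<le> ennreal C \<longleftrightarrow> \<bar>g v\<bar> \<le> C * ip_norm ip v" if "v \<noteq> 0" for v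
    using ip_norm_pos[OF that] assms by (simp add: ennreal_le_iff divide_le_eq)
  then have "sup_quotient ip S g \<le> ennreal C \<longleftrightarrow> (\<forall>v\<in>S - {0}. \<bar>g v\<bar> \<le> C * ip_norm ip v)"
    by (simp add: sup_quotient_def SUP_le_iff)
  also have "\<dots> \<longleftrightarrow> (\<forall>v\<in>S. \<bar>g v\<bar> \<le> C * ip_norm ip v)"
    using assms by (auto simp: ip_norm_nonneg)
  finally show ?thesis .
qed

end

section \<open>Well-posedness of the mixed problem\<close>

text \<open>Completeness of \<open>H\<close> and \<open>K\<close> replaces finite dimension, so that the same results apply to the
  full Hilbert spaces and to the discrete subspaces. The upper bound is required of all \<open>u\<close> and \<open>v\<close>,
  since stability compares a discrete solution with a \<open>u\<close> outside \<open>K\<close>.\<close>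

locale mixed_problem = weighted_inner_product ip C1 C2
  for ip :: "'v::real_normed_vector \<Rightarrow> 'v \<Rightarrow> real" and C1 C2 :: real +
  fixes b :: "'u::real_normed_vector \<Rightarrow> 'v \<Rightarrow> real" and M \<gamma> :: real
    and H :: "'v set" and K :: "'u set"
  assumes b: "bilinear b" and M: "0 \<le> M" and \<gamma>: "0 < \<gamma>"
    and b_bound: "\<And>u v. \<bar>b u v\<bar> \<le> M * norm u * ip_norm ip v"
    and H: "subspace H" "complete H" and K: "subspace K" "complete K"
    and inf_sup: "\<And>u. u \<in> K \<Longrightarrow> ennreal (\<gamma> * norm u) \<le> sup_quotient ip H (b u)"
begin

sublocale ip: bounded_bilinear ip by (rule bounded_bilinear_ip)
sublocale b: bounded_bilinear b
  by (rule bounded_bilinear_if_ip_bounded[OF b M b_bound])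

lemma norm_le_if_bounded_on_test_space:
  assumes "u \<in> K" "0 \<le> C" "\<And>v. v \<in> H \<Longrightarrow> \<bar>b u v\<bar> \<le> C * ip_norm ip v"
  shows "\<gamma> * norm u \<le> C"
proof -
  have "sup_quotient ip H (b u) \<le> ennreal C"
    using sup_quotient_le_iff[of C "b u" H] assms by (simp add: b.zero_right)
  with inf_sup[OF assms(1)] have "ennreal (\<gamma> * norm u) \<le> ennreal C"
    by (rule order_trans)
  then show ?thesis using assms(2) by (simp add: ennreal_le_iff)
qed

text \<open>The Riesz representative in \<open>H\<close> of \<open>b u\<close>; the choice operator picks the vector whose existence
  \<open>Riesz_representation\<close> provides. By the Cauchy-Schwarz inequality the quotient
  \<open>\<bar>b u v\<bar> / ip_norm ip v\<close> is at most \<open>ip_norm ip (supremizer u)\<close> on \<open>H\<close>, and this value is attained at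
  the supremizer if it is nonzero.\<close>

definition supremizer :: "'u \<Rightarrow> 'v" where
  "supremizer u = (SOME z. z \<in> H \<and> (\<forall>v\<in>H. ip z v = b u v))"

lemma supremizer: "supremizer u \<in> H" "v \<in> H \<Longrightarrow> ip (supremizer u) v = b u v"
proof -
  have "\<exists>z. z \<in> H \<and> (\<forall>v\<in>H. ip z v = b u v)"
    using Riesz_representation[OF b.bounded_linear_right H] by blast
  from someI_ex[OF this]
  show "supremizer u \<in> H" "v \<in> H \<Longrightarrow> ip (supremizer u) v = b u v"
    by (auto simp: supremizer_def)
qed

lemma ip_separates:
  assumes "z \<in> H" "z' \<in> H" "\<And>v. v \<in> H \<Longrightarrow> ip z v = ip z' v"
  shows "z = z'"
proof -
  have "ip (z - z') (z - z') = 0"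
    using assms H(1) subspace_diff[of H z z'] by (simp add: ip.diff_left)
  then show ?thesis using ip_pos[of "z - z'"] by auto
qed

lemma supremizer_linear: "linear supremizer"
  by (rule linearI; rule ip_separates)
    (simp_all add: supremizer H(1) subspace_add subspace_scale ip.add_left ip.scaleR_left
      b.add_left b.scaleR_left)

lemma ip_norm_supremizer_upper: "ip_norm ip (supremizer u) \<le> M * norm u"
proof (cases "supremizer u = 0")
  case True
  then show ?thesis using M by (simp add: ip_norm_def ip.zero_left)
next
  case False
  have "(ip_norm ip (supremizer u))\<^sup>2 \<le> M * norm u * ip_norm ip (supremizer u)"
    using b_bound[of u "supremizer u"] supremizer(1)[of u]
      supremizer(2)[OF supremizer(1), of u u] by (simp add: ip_norm_power2)
  then show ?thesis using ip_norm_pos[OF False] by (simp add: power2_eq_square)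
qed

text \<open>The inf-sup condition restated: the supremum is at most the norm of the supremizer.\<close>

lemma ip_norm_supremizer_lower: "u \<in> K \<Longrightarrow> \<gamma> * norm u \<le> ip_norm ip (supremizer u)"
  using ip_Cauchy_Schwarz[of "supremizer u"]
  by (intro norm_le_if_bounded_on_test_space) (simp_all add: ip_norm_nonneg flip: supremizer(2))

lemma supremizer_bounded_linear: "bounded_linear supremizer"
proof -
  have "norm (supremizer u) \<le> norm u * (C2 * M)" for u
  proof -
    have "norm (supremizer u) \<le> C2 * ip_norm ip (supremizer u)" by (rule norm_equiv)
    also have "\<dots> \<le> C2 * (M * norm u)"
      using ip_norm_supremizer_upper C_pos by (intro mult_left_mono) auto
    finally show ?thesis by (simp add: ac_simps)
  qed
  then show ?thesis
    using supremizer_linear by (intro bounded_linear.intro bounded_linear_axioms.intro) auto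
qed

text \<open>With \<open>g\<close> representing \<open>f\<close> on \<open>H\<close>, the component \<open>u\<close> solves the normal equations of
  the approximation of \<open>g\<close> by vectors \<open>supremizer w\<close>, whose form is coercive with constant
  \<open>\<gamma>\<^sup>2\<close>, and \<open>r\<close> is the residual of this least squares problem.\<close>

lemma mixed_solution_exists: "\<exists>p. mixed_solution ip b f H K p"
proof -
  let ?T = supremizer
  interpret T: bounded_linear ?T by (rule supremizer_bounded_linear)
  obtain g where g: "g \<in> H" "\<And>v. v \<in> H \<Longrightarrow> ip g v = blinfun_apply f v"
    using Riesz_representation[OF blinfun.bounded_linear_right H] by blast
  have "\<exists>u\<in>K. \<forall>w\<in>K. ip (?T u) (?T w) = blinfun_apply f (?T w)"
  proof (rule coercive_form_represents_functional[where c = "\<gamma>\<^sup>2"])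
    show "bounded_bilinear (\<lambda>u w. ip (?T u) (?T w))"
      by (rule ip.comp[OF T.bounded_linear_axioms T.bounded_linear_axioms])
    show "bounded_linear (\<lambda>w. blinfun_apply f (?T w))"
      by (rule bounded_linear_compose[OF blinfun.bounded_linear_right T.bounded_linear_axioms])
    fix w assume "w \<in> K"
    then have "(\<gamma> * norm w)\<^sup>2 \<le> (ip_norm ip (?T w))\<^sup>2"
      using ip_norm_supremizer_lower \<gamma> by (intro power_mono) auto
    then show "\<gamma>\<^sup>2 * (norm w)\<^sup>2 \<le> ip (?T w) (?T w)"
      by (simp add: power_mult_distrib ip_norm_power2)
  qed (use \<gamma> K ip_commute in auto)
  then obtain u where u: "u \<in> K" "\<And>w. w \<in> K \<Longrightarrow> ip (?T u) (?T w) = blinfun_apply f (?T w)"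
    by blast
  have "g - ?T u \<in> H" using H(1) g(1) supremizer(1) by (rule subspace_diff)
  moreover have "b w (g - ?T u) = 0" if "w \<in> K" for w
  proof -
    have "b w (g - ?T u) = ip (g - ?T u) (?T w)"
      using supremizer(2)[OF \<open>g - ?T u \<in> H\<close>] ip_commute by metis
    then show ?thesis using u(2)[OF that] g(2)[OF supremizer(1)] by (simp add: ip.diff_left)
  qed
  moreover have "ip (g - ?T u) v + b u v = blinfun_apply f v" if "v \<in> H" for v
    using that g(2) supremizer(2) by (simp add: ip.diff_left)
  ultimately show ?thesis using u(1) by (auto simp: mixed_solution_def)
qed

text \<open>The residual is orthogonal to the supremizer \<open>z\<close> of \<open>uh\<close>, because \<open>b uh r = 0\<close>. Testing the first
  equation with \<open>z\<close> thus leaves \<open>ip z z = b u z\<close>, so \<open>ip_norm ip z \<le> M * norm u\<close>.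
  In particular \<open>uh = 0\<close> for zero data, from which uniqueness follows.\<close>

lemma mixed_solution_stable:
  assumes sol: "mixed_solution ip b f H K (r, uh)"
    and u: "\<And>v. v \<in> H \<Longrightarrow> blinfun_apply f v = b u v"
  shows "\<gamma> * norm uh \<le> M * norm u"
proof -
  let ?z = "supremizer uh"
  have r: "r \<in> H" "uh \<in> K" "b uh r = 0"
    and eq: "ip r ?z + b uh ?z = b u ?z"
    using sol u[OF supremizer(1)] supremizer(1) by (auto simp: mixed_solution_def)
  have "ip r ?z = 0" using supremizer(2)[OF r(1)] ip_commute r(3) by metis
  then have "ip ?z ?z = b u ?z" using eq supremizer by simp
  then have "(ip_norm ip ?z)\<^sup>2 \<le> M * norm u * ip_norm ip ?z"
    using b_bound[of u ?z] by (simp add: ip_norm_power2)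
  then have "ip_norm ip ?z \<le> M * norm u"
    using ip_norm_nonneg[of ?z] M
    by (cases "ip_norm ip ?z = 0") (auto simp: power2_eq_square)
  then show ?thesis using ip_norm_supremizer_lower[OF r(2)] by simp
qed

lemma mixed_solution_add_scaleR:
  assumes "mixed_solution ip b f H K (r, u)" "mixed_solution ip b g H K (s, w)"
  shows "mixed_solution ip b (f + t *\<^sub>R g) H K (r + t *\<^sub>R s, u + t *\<^sub>R w)"
proof -
  have "ip (r + t *\<^sub>R s) v + b (u + t *\<^sub>R w) v = (ip r v + b u v) + t * (ip s v + b w v)" for v
    by (simp add: ip.add_left ip.scaleR_left b.add_left b.scaleR_left algebra_simps)
  then show ?thesis
    using assms H(1) K(1)
    by (auto simp: mixed_solution_def subspace_add subspace_scale b.add_right b.scaleR_right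
        blinfun.add_left blinfun.scaleR_left)
qed

lemma mixed_solution_unique:
  assumes "mixed_solution ip b f H K p" "mixed_solution ip b f H K q"
  shows "p = q"
proof -
  obtain r u s w where p: "p = (r, u)" and q: "q = (s, w)" by fastforce
  have hom: "mixed_solution ip b 0 H K (r - s, u - w)"
    using mixed_solution_add_scaleR[of f r u f s w "-1"] assms by (simp add: p q)
  then have "\<gamma> * norm (u - w) \<le> M * norm (0::'u)"
    by (rule mixed_solution_stable) (simp add: b.zero_left)
  then have "u = w" using \<gamma> by (simp add: mult_le_0_iff)
  then have "r - s \<in> H" "ip (r - s) (r - s) = 0"
    using hom by (auto simp: mixed_solution_def b.zero_left)
  then have "r = s" using ip_pos[of "r - s"] by auto
  with \<open>u = w\<close> show ?thesis by (simp add: p q)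
qed

lemma mixed_solution_ex1: "\<exists>!p. mixed_solution ip b f H K p"
  using mixed_solution_exists mixed_solution_unique by blast

text \<open>Without restrictions on the test functions, the second equation says that \<open>b w r = 0\<close> for all
  \<open>w\<close>. Compatibility then gives \<open>f r = 0\<close>, so testing the first equation with \<open>r\<close> leaves
  \<open>ip r r = 0\<close>.\<close>

lemma mixed_solution_full_space:
  assumes H: "H = UNIV" and K: "K = UNIV"
    and compat: "\<And>v. (\<And>u. b u v = 0) \<Longrightarrow> blinfun_apply f v = 0"
  shows "mixed_solution ip b f H K (r, u) \<longleftrightarrow> r = 0 \<and> variational_solution b f u"
proof
  assume sol: "mixed_solution ip b f H K (r, u)"
  then have r: "b w r = 0" for w by (simp add: mixed_solution_def K)
  moreover have eq: "ip r v + b u v = blinfun_apply f v" for v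
    using sol by (simp add: mixed_solution_def H)
  ultimately have "ip r r = 0" using compat[of r] eq[of r] by simp
  then have "r = 0" using ip_pos[of r] by auto
  then show "r = 0 \<and> variational_solution b f u"
    using eq by (simp add: variational_solution_def ip.zero_left)
qed (auto simp: mixed_solution_def variational_solution_def H K ip.zero_left b.zero_right)

end

section \<open>Quasi-optimality\<close>

text \<open>The map \<open>P\<close> sends \<open>x\<close> to the second component of the mixed solution with data \<open>b x\<close>. By
  uniqueness it is linear and fixes \<open>K\<close>, where the residual is zero, so it is a projection, with norm
  bound \<open>M / \<gamma>\<close> by stability. Since \<open>P w = w\<close>, its complement takes the same value at \<open>u\<close>
  and at \<open>u - w\<close>. The trial space must be nontrivial for \<open>P\<close> to be nonzero.\<close>

lemma mixed_solution_quasi_optimal: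
  fixes b :: "'u::real_inner \<Rightarrow> 'v::real_normed_vector \<Rightarrow> real"
  assumes "mixed_problem ip C1 C2 b M \<gamma> H K"
    and sol: "mixed_solution ip b f H K (r, uh)"
    and u: "\<And>v. blinfun_apply f v = b u v" and "K \<noteq> {0}" and "w \<in> K"
  shows "norm (u - uh) \<le> M / \<gamma> * norm (u - w)"
proof -
  interpret mixed_problem ip C1 C2 b M \<gamma> H K by fact
  define F where "F = (\<lambda>x. Blinfun (b x))"
  have F: "blinfun_apply (F x) v = b x v" for x v
    by (simp add: F_def bounded_linear_Blinfun_apply[OF b.bounded_linear_right])
  define P where "P = (\<lambda>x. snd (THE p. mixed_solution ip b (F x) H K p))"
  have P_eqI: "P x = y" if "mixed_solution ip b (F x) H K (s, y)" for x y s
    using the1_equality[OF mixed_solution_ex1 that] by (simp add: P_def)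
  have P_ex: "\<exists>s. mixed_solution ip b (F x) H K (s, P x)" for x
    using mixed_solution_exists[of "F x"] P_eqI by (metis surj_pair)
  have F_lin: "F (x + t *\<^sub>R y) = F x + t *\<^sub>R F y" for x y t
    by (rule blinfun_eqI) (simp add: F blinfun.add_left blinfun.scaleR_left b.add_left b.scaleR_left)
  have P_lin: "P (x + t *\<^sub>R y) = P x + t *\<^sub>R P y" for x y t
    using P_ex[of x] P_ex[of y] mixed_solution_add_scaleR P_eqI by (metis F_lin)
  have P_fix: "P x = x" if "x \<in> K" for x
    using that H(1) F by (intro P_eqI[of _ 0])
      (simp add: mixed_solution_def subspace_0 ip.zero_left b.zero_right)
  have P0: "P 0 = 0" using P_fix K(1) subspace_0 by blast
  have "linear P"
    by (rule linearI) (use P_lin[of _ 1] P_lin[of 0] P0 in auto)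
  have P_in: "P x \<in> K" for x using P_ex[of x] by (auto simp: mixed_solution_def)
  have P_bound: "norm (P x) \<le> M / \<gamma> * norm x" for x
    using P_ex[of x] mixed_solution_stable[of "F x" _ "P x" x] F \<gamma> by (auto simp: field_simps)
  obtain z where "z \<in> K" "z \<noteq> 0" using \<open>K \<noteq> {0}\<close> K(1) subspace_0 by blast
  have "f = F u" by (rule blinfun_eqI) (simp add: F u)
  then have "P u = uh" using sol P_eqI by blast
  then have "P (u - w) = uh - w"
    using P_lin[of u "-1" w] P_fix[OF \<open>w \<in> K\<close>] by simp
  moreover have "norm ((u - w) - P (u - w)) \<le> M / \<gamma> * norm (u - w)"
    using \<open>linear P\<close> P_fix P_in P_bound \<open>z \<in> K\<close> \<open>z \<noteq> 0\<close>
    by (intro norm_complement_projection_le[where z = z]) auto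
  ultimately show ?thesis by simp
qed

section \<open>The weighted mixed method\<close>

theorem theorem2:
  fixes ip :: "'v::{real_inner, complete_space} \<Rightarrow> 'v \<Rightarrow> real"
    and b :: "'u::{real_inner, complete_space} \<Rightarrow> 'v \<Rightarrow> real"
    and \<Lambda> :: "'l set"
    and ell :: "'l \<Rightarrow> 'v \<Rightarrow>\<^sub>L real"
    and Uh :: "'u set" and Vh :: "'v set"
    and C1 C2 M \<gamma> \<gamma>h :: real
  assumes ip: "is_inner_product ip"
    and C_pos: "C1 > 0" "C2 > 0"
    and norm_equiv: "\<forall>v. C1 * ip_norm ip v \<le> norm v \<and> norm v \<le> C2 * ip_norm ip v"
    and b: "bilinear b"
    and const_pos: "M > 0" "\<gamma> > 0"
    and inf_sup: "\<forall>u. ennreal (\<gamma> * norm u) \<le> sup_quotient ip UNIV (b u)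
                    \<and> sup_quotient ip UNIV (b u) \<le> ennreal (M * norm u)"
    and compat: "\<forall>\<mu>\<in>\<Lambda>. \<forall>v. (\<forall>u. b u v = 0) \<longrightarrow> blinfun_apply (ell \<mu>) v = 0"
    and Uh: "finite_dim_subspace Uh"
    and Vh: "finite_dim_subspace Vh"
    and dims: "dim Vh \<ge> dim Uh"
    and \<gamma>h_pos: "\<gamma>h > 0"
    and discrete_inf_sup: "\<forall>u\<in>Uh. sup_quotient ip Vh (b u) \<ge> ennreal (\<gamma>h * norm u)"
  shows "\<forall>\<mu>\<in>\<Lambda>.
      (\<exists>!u. variational_solution b (ell \<mu>) u) \<and>
      (\<exists>!p. mixed_solution ip b (ell \<mu>) Vh Uh p) \<and>
      (\<forall>u r uh. variational_solution b (ell \<mu>) u \<longrightarrow>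
         mixed_solution ip b (ell \<mu>) Vh Uh (r, uh) \<longrightarrow>
           norm uh \<le> M / \<gamma>h * norm u \<and>
           (Uh \<noteq> {0} \<longrightarrow> norm (u - uh) \<le> M / \<gamma>h * (INF wh\<in>Uh. norm (u - wh))))"
proof (intro ballI conjI allI impI)
  have b_bound: "\<bar>b u v\<bar> \<le> M * norm u * ip_norm ip v" for u v
  proof -
    interpret weighted_inner_product ip C1 C2
      using ip C_pos norm_equiv by unfold_locales auto
    show ?thesis
      using inf_sup sup_quotient_le_iff[of "M * norm u" "b u" UNIV] const_pos
      by (simp add: bilinear_rzero[OF b])
  qed
  interpret weak: mixed_problem ip C1 C2 b M \<gamma> UNIV UNIV
    using ip C_pos norm_equiv b const_pos b_bound inf_sup
    by unfold_locales (auto simp: complete_UNIV)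
  interpret discrete: mixed_problem ip C1 C2 b M \<gamma>h Vh Uh
    using ip C_pos norm_equiv b const_pos b_bound \<gamma>h_pos discrete_inf_sup Uh Vh
    by unfold_locales (auto simp: finite_dim_subspace_def complete_eq_closed
        intro!: closed_finite_dim_subspace)
  fix \<mu> assume \<mu>: "\<mu> \<in> \<Lambda>"
  show "\<exists>!p. mixed_solution ip b (ell \<mu>) Vh Uh p"
    by (rule discrete.mixed_solution_ex1)
  have "mixed_solution ip b (ell \<mu>) UNIV UNIV (r, u) \<longleftrightarrow>
      r = 0 \<and> variational_solution b (ell \<mu>) u" for r u
    using compat \<mu> by (intro weak.mixed_solution_full_space) auto
  then show "\<exists>!u. variational_solution b (ell \<mu>) u"
    using weak.mixed_solution_ex1[of "ell \<mu>"] by (metis surj_pair prod.inject)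
  fix u r uh
  assume u: "variational_solution b (ell \<mu>) u"
    and uh: "mixed_solution ip b (ell \<mu>) Vh Uh (r, uh)"
  from u have eq: "blinfun_apply (ell \<mu>) v = b u v" for v
    by (simp add: variational_solution_def)
  show "norm uh \<le> M / \<gamma>h * norm u"
    using discrete.mixed_solution_stable[OF uh eq] \<gamma>h_pos by (simp add: field_simps)
  assume "Uh \<noteq> {0}"
  have "norm (u - uh) / (M / \<gamma>h) \<le> (INF wh\<in>Uh. norm (u - wh))"
  proof (rule cINF_greatest)
    show "Uh \<noteq> {}" using discrete.K(1) subspace_0 by blast
    fix wh assume "wh \<in> Uh"
    then have "norm (u - uh) \<le> M / \<gamma>h * norm (u - wh)"
      using mixed_solution_quasi_optimal[OF discrete.mixed_problem_axioms uh eq \<open>Uh \<noteq> {0}\<close>]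
      by blast
    then show "norm (u - uh) / (M / \<gamma>h) \<le> norm (u - wh)"
      using const_pos \<gamma>h_pos by (simp add: field_simps)
  qed
  then show "norm (u - uh) \<le> M / \<gamma>h * (INF wh\<in>Uh. norm (u - wh))"
    using const_pos \<gamma>h_pos by (simp add: field_simps)
qed

end
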